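(* Let $D\subset\mathbb C$ be a bounded convex domain and $p\in D$. There exists a harmonic map $f:\mathbb D\to D$ such that $f(0)=p$, $df_0$ is conformal, and $\|df_0\|=M_D(p)$. Furthermore, \[ M_D(p)\le \frac{\operatorname{Per}(D)}{2\pi}. \]
   Context: $\mathbb D=\{z\in\mathbb C:|z|<1\}$. For a domain $D\subset\mathbb C$ and $p\in D$, $M_D(p)$ denotes the supremum of the operator norms $\|df_0\|$ over all harmonic maps $f:\mathbb D\to D$ with $f(0)=p$ whose differential $df_0:\mathbb R^2\to\mathbb R^2$ at $0$ is conformal (i.e. a nonnegative multiple of an orthogonal linear map, orientation preserving or reversing). $\operatorname{Per}(D)$ denotes the perimeter of $D$. *)

theory Defs
  imports "HOL-Analysis.Analysis"
begin

definition harmonic_on :: "complex set \<Rightarrow> (complex \<Rightarrow> complex) \<Rightarrow> bool" where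
  "harmonic_on S f \<longleftrightarrow>
     (\<exists>fx fy fxx fxy fyx fyy.
        (\<forall>z\<in>S. (f has_derivative (\<lambda>h. Re h *\<^sub>R fx z + Im h *\<^sub>R fy z)) (at z)) \<and>
        (\<forall>z\<in>S. (fx has_derivative (\<lambda>h. Re h *\<^sub>R fxx z + Im h *\<^sub>R fxy z)) (at z)) \<and>
        (\<forall>z\<in>S. (fy has_derivative (\<lambda>h. Re h *\<^sub>R fyx z + Im h *\<^sub>R fyy z)) (at z)) \<and>
        continuous_on S fxx \<and> continuous_on S fxy \<and>
        continuous_on S fyx \<and> continuous_on S fyy \<and>
        (\<forall>z\<in>S. fxx z + fyy z = 0))"

text \<open>A real-linear map of R^2 = C is conformal iff it is a nonnegative multiple of an orthogonal
  map, i.e. of the form h |-> c*h (orientation preserving) or h |-> c * cnj h (reversing).\<close>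
definition conformal_linear :: "(complex \<Rightarrow> complex) \<Rightarrow> bool" where
  "conformal_linear L \<longleftrightarrow> (\<exists>c. (\<forall>h. L h = c * h) \<or> (\<forall>h. L h = c * cnj h))"

definition admissible :: "complex set \<Rightarrow> complex \<Rightarrow> (complex \<Rightarrow> complex) \<Rightarrow> bool" where
  "admissible D p f \<longleftrightarrow> harmonic_on (ball 0 1) f \<and> f ` ball 0 1 \<subseteq> D \<and> f 0 = p \<and>
     conformal_linear (frechet_derivative f (at 0))"

definition M :: "complex set \<Rightarrow> complex \<Rightarrow> real" where
  "M D p = Sup {onorm (frechet_derivative f (at 0)) | f. admissible D p f}"

definition curve_length :: "(real \<Rightarrow> complex) \<Rightarrow> real" where
  "curve_length g = Sup {(\<Sum>i<n. norm (g (t (Suc i)) - g (t i))) | n t.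
      t 0 = 0 \<and> t n = 1 \<and> (\<forall>i<n. t i \<le> t (Suc i))}"

definition perimeter :: "complex set \<Rightarrow> real" where
  "perimeter D = (SOME L. \<exists>g. simple_path g \<and> pathstart g = pathfinish g \<and>
      path_image g = frontier D \<and> curve_length g = L)"

end

theory Submission
  imports Defs "HOL-Complex_Analysis.Complex_Analysis"
begin

text \<open>
  Write a harmonic map of the disc as \<open>f = h + cnj g\<close> with \<open>h\<close>, \<open>g\<close> holomorphic. Then \<open>r h'(a)\<close> is a
  Fourier coefficient of \<open>f\<close> on the circle of radius \<open>r\<close> about \<open>a\<close>; pairing antipodal points,
  \<open>2 r |h'(a)|\<close> becomes an average of \<open>(f(z) - f(z')) \<bullet> e\<close> over unit vectors \<open>e\<close>, which is at most
  the mean width of \<open>D\<close>. By Cauchy's formula the perimeter is \<open>\<pi>\<close> times the mean width: a line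
  through \<open>D\<close> meets the boundary at most twice, so by Banach's indicatrix an inscribed polygon
  varies in the direction \<open>e\<close> by at most twice the width; a fine polygon nearly attains this; and
  \<open>|v \<bullet> e|\<close> averages to \<open>2 |v| / \<pi>\<close>.

  The same estimate on smaller discs bounds \<open>h'\<close> and \<open>g'\<close> locally uniformly, so Montel's theorem
  yields an extremal map into the closure of \<open>D\<close>; by the maximum principle, applied to supporting
  half-planes, it does not touch the boundary.
\<close>

section \<open>Symmetry of second derivatives\<close>

definition second_difference ::
    "('a::real_vector \<Rightarrow> 'b::real_vector) \<Rightarrow> 'a \<Rightarrow> 'a \<Rightarrow> 'a \<Rightarrow> 'b" where
  "second_difference f z a b = f (z + a + b) - f (z + a) - f (z + b) + f z"

lemma second_difference_commute: "second_difference f z a b = second_difference f z b a"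
  by (simp add: second_difference_def add_ac)

lemma has_derivative_along_line:
  assumes f': "(f has_derivative f') (at (z + t *\<^sub>R a))"
  shows "((\<lambda>t. f (z + t *\<^sub>R a)) has_derivative (\<lambda>h. h *\<^sub>R f' a)) (at t within S)"
proof -
  have "((\<lambda>t. f (z + t *\<^sub>R a)) has_derivative (\<lambda>h. f' (h *\<^sub>R a))) (at t within S)"
    by (rule has_derivative_compose[of "\<lambda>t. z + t *\<^sub>R a", OF _ f'])
      (auto intro!: derivative_eq_intros)
  then show ?thesis by (simp add: linear_scale[OF has_derivative_linear[OF f']])
qed

lemma second_difference_estimate:
  fixes f :: "'a::real_normed_vector \<Rightarrow> 'b::real_normed_vector"
  assumes f': "\<And>w. w \<in> ball z r \<Longrightarrow> (f has_derivative f' w) (at w)" and A: "linear A"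
    and remainder: "\<And>w. w \<in> ball z r \<Longrightarrow> norm (f' w a - f' z a - A (w - z)) \<le> e * norm (w - z)"
    and r: "norm a + norm b < r" and e: "e \<ge> 0"
  shows "norm (second_difference f z a b - A b) \<le> 2 * e * (norm a + norm b)"
proof -
  define B where "B = e * (norm a + norm b)"
  define \<phi> where "\<phi> t = f (z + b + t *\<^sub>R a) - f (z + t *\<^sub>R a) - t *\<^sub>R A b" for t
  define \<phi>' where "\<phi>' t = f' (z + b + t *\<^sub>R a) a - f' (z + t *\<^sub>R a) a - A b" for t
  have in_ball: "z + v \<in> ball z r"
    and remainder_le: "norm (f' (z + v) a - f' z a - A v) \<le> B"
    if "norm v \<le> norm a + norm b" for v
  proof -
    show "z + v \<in> ball z r" using that r by (simp add: dist_norm)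
    from remainder[OF this] show "norm (f' (z + v) a - f' z a - A v) \<le> B"
      using mult_left_mono[OF that e] by (simp add: B_def)
  qed
  have "norm (\<phi> 1 - \<phi> 0) \<le> 2 * B * norm (1 - 0 :: real)"
  proof (rule differentiable_bound[of "{0..1}" \<phi> "\<lambda>t h. h *\<^sub>R \<phi>' t"])
    fix t :: real assume "t \<in> {0..1}"
    then have "norm (t *\<^sub>R a) \<le> norm a" by (simp add: mult_left_le_one_le)
    then have small: "norm (t *\<^sub>R a) \<le> norm a + norm b" "norm (b + t *\<^sub>R a) \<le> norm a + norm b"
      using norm_ge_zero[of b] norm_triangle_ineq[of b "t *\<^sub>R a"] by linarith+
    have "(f has_derivative f' (z + t *\<^sub>R a)) (at (z + t *\<^sub>R a))"
      "(f has_derivative f' (z + b + t *\<^sub>R a)) (at (z + b + t *\<^sub>R a))"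
      using f'[OF in_ball[OF small(1)]] f'[OF in_ball[OF small(2)]] by (simp_all add: add.assoc)
    from this[THEN has_derivative_along_line]
    show "(\<phi> has_derivative (\<lambda>h. h *\<^sub>R \<phi>' t)) (at t within {0..1})"
      unfolding \<phi>_def \<phi>'_def by (auto intro!: derivative_eq_intros simp: scaleR_diff_right)
    have "\<phi>' t = (f' (z + (b + t *\<^sub>R a)) a - f' z a - A (b + t *\<^sub>R a))
        - (f' (z + t *\<^sub>R a) a - f' z a - A (t *\<^sub>R a))"
      using A by (simp add: \<phi>'_def linear_add add.assoc)
    also have "norm \<dots> \<le> B + B"
      by (intro norm_triangle_le_diff add_mono remainder_le small)
    finally show "onorm (\<lambda>h. h *\<^sub>R \<phi>' t) \<le> 2 * B"
      by (intro onorm_le) (simp add: mult.commute mult_left_mono)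
  qed auto
  then show ?thesis
    by (simp add: B_def \<phi>_def second_difference_def algebra_simps)
qed

lemma second_difference_scaled_estimate:
  fixes f :: "'a::real_normed_vector \<Rightarrow> 'b::real_normed_vector"
  assumes f': "\<And>w. w \<in> ball z r \<Longrightarrow> (f has_derivative f' w) (at w)" and A: "linear A"
    and remainder: "\<And>w. w \<in> ball z r \<Longrightarrow> norm (f' w a - f' z a - A (w - z)) \<le> e * norm (w - z)"
    and s: "0 < s" "s * (norm a + norm b) < r" and e: "e \<ge> 0"
  shows "norm (second_difference f z (s *\<^sub>R a) (s *\<^sub>R b) - s\<^sup>2 *\<^sub>R A b)
    \<le> s\<^sup>2 * (2 * e * (norm a + norm b))"
proof -
  have norm_s: "norm (s *\<^sub>R a) + norm (s *\<^sub>R b) = s * (norm a + norm b)"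
    using s by (simp add: distrib_left)
  have "0 \<le> s * (norm a + norm b)" using s by simp
  then have r: "r > 0" using s by linarith
  have "norm (second_difference f z (s *\<^sub>R a) (s *\<^sub>R b) - (\<lambda>k. s *\<^sub>R A k) (s *\<^sub>R b))
      \<le> 2 * (s * e) * (norm (s *\<^sub>R a) + norm (s *\<^sub>R b))"
  proof (rule second_difference_estimate[OF f'])
    fix w assume w: "w \<in> ball z r"
    have "f' w (s *\<^sub>R a) - f' z (s *\<^sub>R a) - s *\<^sub>R A (w - z) = s *\<^sub>R (f' w a - f' z a - A (w - z))"
      using f'[OF w, THEN has_derivative_linear] f'[of z, THEN has_derivative_linear] r
      by (simp add: linear_scale scaleR_diff_right)
    then show "norm (f' w (s *\<^sub>R a) - f' z (s *\<^sub>R a) - s *\<^sub>R A (w - z)) \<le> s * e * norm (w - z)"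
      using remainder[OF w] s by (simp add: mult.assoc)
  next
    show "norm (s *\<^sub>R a) + norm (s *\<^sub>R b) < r" using s norm_s by linarith
  qed (use s e A in \<open>auto intro: linear_compose_scale_right\<close>)
  then show ?thesis
    unfolding norm_s using A by (simp add: linear_scale power2_eq_square mult_ac)
qed

lemma second_difference_quotient_tendsto:
  fixes f :: "'a::real_normed_vector \<Rightarrow> 'b::real_normed_vector"
  assumes S: "open S" "z \<in> S" and f': "\<And>w. w \<in> S \<Longrightarrow> (f has_derivative f' w) (at w)"
    and A: "((\<lambda>w. f' w a) has_derivative A) (at z)"
  shows "((\<lambda>s. second_difference f z (s *\<^sub>R a) (s *\<^sub>R b) /\<^sub>R s\<^sup>2) \<longlongrightarrow> A b) (at_right 0)"
proof (rule tendstoI)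
  fix \<epsilon> :: real assume \<epsilon>: "\<epsilon> > 0"
  define N where "N = norm a + norm b + 1"
  define e where "e = \<epsilon> / (2 * N)"
  have N: "N > 0" unfolding N_def by (intro add_nonneg_pos add_nonneg_nonneg) simp_all
  have e: "e > 0" using \<epsilon> N by (simp add: e_def)
  obtain d where d: "d > 0"
    "\<And>w. norm (w - z) < d \<Longrightarrow> norm (f' w a - f' z a - A (w - z)) \<le> e * norm (w - z)"
    using A e has_derivative_at_alt[of "\<lambda>w. f' w a" A z] by metis
  obtain \<delta> where \<delta>: "\<delta> > 0" "ball z \<delta> \<subseteq> S" using S open_contains_ball by blast
  let ?r = "min d \<delta>"
  have "dist (second_difference f z (s *\<^sub>R a) (s *\<^sub>R b) /\<^sub>R s\<^sup>2) (A b) < \<epsilon>"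
    if s: "0 < s" "s < ?r / N" for s
  proof -
    have sN: "s * (norm a + norm b) < s * N" "s * N < ?r"
      using s N by (simp_all add: N_def pos_less_divide_eq)
    have "s\<^sup>2 *\<^sub>R (second_difference f z (s *\<^sub>R a) (s *\<^sub>R b) /\<^sub>R s\<^sup>2 - A b)
        = second_difference f z (s *\<^sub>R a) (s *\<^sub>R b) - s\<^sup>2 *\<^sub>R A b"
      using s(1) by (simp add: scaleR_diff_right)
    also have "norm \<dots> \<le> s\<^sup>2 * (2 * e * (norm a + norm b))"
    proof (rule second_difference_scaled_estimate)
      show "(f has_derivative f' w) (at w)" if "w \<in> ball z ?r" for w
        using that \<delta> by (intro f') auto
      show "norm (f' w a - f' z a - A (w - z)) \<le> e * norm (w - z)" if "w \<in> ball z ?r" for w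
        using that by (intro d) (simp add: dist_norm norm_minus_commute)
      show "s * (norm a + norm b) < ?r" using sN by linarith
    qed (use s e A in \<open>auto intro: has_derivative_linear\<close>)
    also have "\<dots> < s\<^sup>2 * (2 * e * N)" using s e by (simp add: N_def)
    also have "\<dots> = s\<^sup>2 * \<epsilon>" using N by (simp add: e_def)
    finally show ?thesis using s by (simp add: dist_norm)
  qed
  moreover have "0 < ?r / N" using d \<delta> N by simp
  ultimately show "\<forall>\<^sub>F s in at_right 0.
      dist (second_difference f z (s *\<^sub>R a) (s *\<^sub>R b) /\<^sub>R s\<^sup>2) (A b) < \<epsilon>"
    unfolding eventually_at_right_field by blast
qed

lemma second_derivative_symmetric:
  fixes f :: "'a::real_normed_vector \<Rightarrow> 'b::real_normed_vector"
  assumes "open S" "z \<in> S" "\<And>w. w \<in> S \<Longrightarrow> (f has_derivative f' w) (at w)"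
    and A: "((\<lambda>w. f' w a) has_derivative A) (at z)"
    and B: "((\<lambda>w. f' w b) has_derivative B) (at z)"
  shows "A b = B a"
proof (rule tendsto_unique[OF trivial_limit_at_right_real])
  show "((\<lambda>s. second_difference f z (s *\<^sub>R a) (s *\<^sub>R b) /\<^sub>R s\<^sup>2) \<longlongrightarrow> A b) (at_right 0)"
    by (rule second_difference_quotient_tendsto[OF assms(1-3) A])
  show "((\<lambda>s. second_difference f z (s *\<^sub>R a) (s *\<^sub>R b) /\<^sub>R s\<^sup>2) \<longlongrightarrow> B a) (at_right 0)"
    unfolding second_difference_commute[of f z "_ *\<^sub>R a"]
    by (rule second_difference_quotient_tendsto[OF assms(1-3) B])
qed

section \<open>Harmonic maps and holomorphic functions\<close>

lemma has_derivative_holomorphic_plus_cnj: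
  assumes "(h has_field_derivative h') (at z)" "(g has_field_derivative g') (at z)"
  shows "((\<lambda>z. h z + cnj (g z)) has_derivative (\<lambda>k. h' * k + cnj (g' * k))) (at z)"
  by (rule derivative_eq_intros assms[unfolded has_field_derivative_def] refl)+

lemma has_derivative_holomorphic_plus_cnj_partials:
  assumes "(h has_field_derivative h') (at z)" "(g has_field_derivative g') (at z)"
  shows "((\<lambda>z. h z + cnj (g z)) has_derivative
    (\<lambda>k. Re k *\<^sub>R (h' + cnj g') + Im k *\<^sub>R (\<i> * h' + cnj (\<i> * g')))) (at z)"
  by (rule has_derivative_eq_rhs[OF has_derivative_holomorphic_plus_cnj[OF assms]])
    (auto simp: fun_eq_iff complex_eq_iff algebra_simps)

lemma harmonic_on_holomorphic_plus_cnj: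
  assumes S: "open S" and h: "h holomorphic_on S" and g: "g holomorphic_on S"
  shows "harmonic_on S (\<lambda>z. h z + cnj (g z))"
proof -
  note h' = holomorphic_deriv[OF h S] and g' = holomorphic_deriv[OF g S]
  note h'' = holomorphic_deriv[OF h' S] and g'' = holomorphic_deriv[OF g' S]
  note deriv = holomorphic_derivI[OF h S] holomorphic_derivI[OF g S]
    and deriv' = holomorphic_derivI[OF h' S] holomorphic_derivI[OF g' S]
  note partials = has_derivative_holomorphic_plus_cnj_partials
  let ?f\<^sub>x = "\<lambda>z. deriv h z + cnj (deriv g z)"
  let ?f\<^sub>y = "\<lambda>z. \<i> * deriv h z + cnj (\<i> * deriv g z)"
  let ?f\<^sub>x\<^sub>x = "\<lambda>z. deriv (deriv h) z + cnj (deriv (deriv g) z)"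
  let ?f\<^sub>x\<^sub>y = "\<lambda>z. \<i> * deriv (deriv h) z + cnj (\<i> * deriv (deriv g) z)"
  let ?f\<^sub>y\<^sub>y = "\<lambda>z. \<i> * (\<i> * deriv (deriv h) z) + cnj (\<i> * (\<i> * deriv (deriv g) z))"
  show ?thesis
    unfolding harmonic_on_def
  proof (rule exI[of _ ?f\<^sub>x], rule exI[of _ ?f\<^sub>y], rule exI[of _ ?f\<^sub>x\<^sub>x], rule exI[of _ ?f\<^sub>x\<^sub>y],
      rule exI[of _ ?f\<^sub>x\<^sub>y], rule exI[of _ ?f\<^sub>y\<^sub>y], intro conjI ballI)
    fix z assume z: "z \<in> S"
    show "((\<lambda>z. h z + cnj (g z)) has_derivative (\<lambda>k. Re k *\<^sub>R ?f\<^sub>x z + Im k *\<^sub>R ?f\<^sub>y z)) (at z)"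
      by (intro partials deriv z)
    show "(?f\<^sub>x has_derivative (\<lambda>k. Re k *\<^sub>R ?f\<^sub>x\<^sub>x z + Im k *\<^sub>R ?f\<^sub>x\<^sub>y z)) (at z)"
      by (intro partials deriv' z)
    show "(?f\<^sub>y has_derivative (\<lambda>k. Re k *\<^sub>R ?f\<^sub>x\<^sub>y z + Im k *\<^sub>R ?f\<^sub>y\<^sub>y z)) (at z)"
      by (intro partials DERIV_cmult deriv' z)
  qed (auto intro!: continuous_intros h''[THEN holomorphic_on_imp_continuous_on]
      g''[THEN holomorphic_on_imp_continuous_on])
qed

lemma harmonic_on_imp_wirtinger:
  assumes S: "open S" and f: "harmonic_on S f"
  obtains P Q where "P holomorphic_on S" "Q holomorphic_on S"
    "\<And>z. z \<in> S \<Longrightarrow> (f has_derivative (\<lambda>k. P z * k + cnj (Q z * k))) (at z)"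
proof -
  obtain fx fy fxx fxy fyx fyy where
    f': "\<And>z. z \<in> S \<Longrightarrow> (f has_derivative (\<lambda>k. Re k *\<^sub>R fx z + Im k *\<^sub>R fy z)) (at z)" and
    fx: "\<And>z. z \<in> S \<Longrightarrow> (fx has_derivative (\<lambda>k. Re k *\<^sub>R fxx z + Im k *\<^sub>R fxy z)) (at z)" and
    fy: "\<And>z. z \<in> S \<Longrightarrow> (fy has_derivative (\<lambda>k. Re k *\<^sub>R fyx z + Im k *\<^sub>R fyy z)) (at z)" and
    laplace: "\<And>z. z \<in> S \<Longrightarrow> fxx z + fyy z = 0"
    using f unfolding harmonic_on_def by blast
  define P where "P z = (fx z - \<i> * fy z) / 2" for z
  define Q where "Q z = cnj ((fx z + \<i> * fy z) / 2)" for z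
  have fxy: "fxy z = fyx z" if "z \<in> S" for z
    using second_derivative_symmetric[OF S that f', of 1 _ \<i>] fx[OF that] fy[OF that] by fastforce
  have fyy: "fyy z = - fxx z" if "z \<in> S" for z
    using laplace[OF that] by (simp add: eq_neg_iff_add_eq_0 add.commute)
  show ?thesis
  proof (rule that)
    have "(P has_field_derivative (fxx z - \<i> * fyx z) / 2) (at z)" if "z \<in> S" for z
      unfolding has_field_derivative_def P_def
      by (rule derivative_eq_intros fx fy that refl | simp)+
        (auto simp: fun_eq_iff fxy[OF that] fyy[OF that] complex_eq_iff field_simps)
    then show "P holomorphic_on S" using S by (auto simp: holomorphic_on_open)
    have "(Q has_field_derivative cnj ((fxx z + \<i> * fyx z) / 2)) (at z)" if "z \<in> S" for z
      unfolding has_field_derivative_def Q_def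
      by (rule derivative_eq_intros fx fy that refl | simp)+
        (auto simp: fun_eq_iff fxy[OF that] fyy[OF that] complex_eq_iff field_simps)
    then show "Q holomorphic_on S" using S by (auto simp: holomorphic_on_open)
    show "(f has_derivative (\<lambda>k. P z * k + cnj (Q z * k))) (at z)" if "z \<in> S" for z
      by (rule has_derivative_eq_rhs[OF f'[OF that]])
        (auto simp: fun_eq_iff P_def Q_def complex_eq_iff field_simps)
  qed
qed

text \<open>The symmetric normalisation at \<open>a\<close> survives exchanging \<open>h\<close> and \<open>g\<close> by a reflection.\<close>

lemma harmonic_on_imp_holomorphic_plus_cnj:
  assumes S: "open S" "convex S" "a \<in> S" and f: "harmonic_on S f"
  obtains h g where "h holomorphic_on S" "g holomorphic_on S"
    "\<forall>z\<in>S. f z = h z + cnj (g z)" "h a = f a / 2" "g a = cnj (f a / 2)"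
proof -
  obtain P Q where P: "P holomorphic_on S" and Q: "Q holomorphic_on S"
    and f': "\<And>z. z \<in> S \<Longrightarrow> (f has_derivative (\<lambda>k. P z * k + cnj (Q z * k))) (at z)"
    using harmonic_on_imp_wirtinger[OF S(1) f] by blast
  obtain h where h: "\<And>z. z \<in> S \<Longrightarrow> (h has_field_derivative P z) (at z)"
    using holomorphic_convex_primitive'[OF S(2,1) P] S(1) by (metis at_within_open)
  obtain g where g: "\<And>z. z \<in> S \<Longrightarrow> (g has_field_derivative Q z) (at z)"
    using holomorphic_convex_primitive'[OF S(2,1) Q] S(1) by (metis at_within_open)
  have hol: "h holomorphic_on S" "g holomorphic_on S"
    using h g S(1) by (auto simp: holomorphic_on_open)
  have "((\<lambda>z. f z - (h z + cnj (g z))) has_derivative (\<lambda>_. 0)) (at z within S)" if "z \<in> S" for z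
    using has_derivative_diff[OF f'[OF that]
        has_derivative_holomorphic_plus_cnj[OF h[OF that] g[OF that]]]
    by (simp add: has_derivative_at_withinI)
  from has_derivative_zero_constant[OF S(2) this]
  obtain c where c: "\<And>z. z \<in> S \<Longrightarrow> f z - (h z + cnj (g z)) = c" by blast
  show ?thesis
  proof (rule that)
    show "(\<lambda>z. h z + (f a / 2 - h a)) holomorphic_on S"
      "(\<lambda>z. g z + (cnj (f a / 2) - g a)) holomorphic_on S"
      by (intro holomorphic_intros hol)+
    show "\<forall>z\<in>S. f z = h z + (f a / 2 - h a) + cnj (g z + (cnj (f a / 2) - g a))"
      using c c[OF S(3)] by (auto simp: algebra_simps)
  qed simp_all
qed

lemma harmonic_in_closure_imp_in_open_convex:
  fixes D :: "complex set"
  assumes D: "open D" "convex D" and S: "open S" "connected S"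
    and h: "h holomorphic_on S" and g: "g holomorphic_on S"
    and closure: "\<And>z. z \<in> S \<Longrightarrow> h z + cnj (g z) \<in> closure D"
    and a: "a \<in> S" "h a + cnj (g a) \<in> D" and z: "z \<in> S"
  shows "h z + cnj (g z) \<in> D"
proof (rule ccontr)
  let ?f = "\<lambda>z. h z + cnj (g z)"
  assume "?f z \<notin> D"
  then obtain u where u: "\<And>y. y \<in> closure D \<Longrightarrow> u \<bullet> ?f z \<le> u \<bullet> y" "\<And>y. y \<in> D \<Longrightarrow> u \<bullet> ?f z < u \<bullet> y"
    using supporting_hyperplane_relative_frontier[OF D(2) closure[OF z]] rel_interior_open[OF D(1)]
    by metis
  define F where "F x = - (cnj u * h x + u * g x)" for x
  have Re_F: "Re (F x) = - (u \<bullet> ?f x)" for x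
    by (simp add: F_def inner_complex_def algebra_simps)
  have "(\<lambda>x. exp (F x)) constant_on S"
  proof (rule maximum_modulus_principle[OF _ S S(1) subset_refl z])
    show "(\<lambda>x. exp (F x)) holomorphic_on S"
      unfolding F_def by (intro holomorphic_intros h g)
    show "norm (exp (F x)) \<le> norm (exp (F z))" if "x \<in> S" for x
      using u(1)[OF closure[OF that]] by (simp add: Re_F)
  qed
  then have "norm (exp (F a)) = norm (exp (F z))" using a(1) z by (metis constant_on_def)
  then show False using u(2)[OF a(2)] by (simp add: Re_F)
qed

section \<open>Widths\<close>

definition width :: "'a::real_inner set \<Rightarrow> 'a \<Rightarrow> real" where
  "width D u = (SUP x\<in>D. x \<bullet> u) - (INF x\<in>D. x \<bullet> u)"

definition mean_width :: "complex set \<Rightarrow> real" where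
  "mean_width D = integral {0..2*pi} (\<lambda>t. width D (cis t)) / (2 * pi)"

lemma bounded_imp_bdd_inner:
  fixes D :: "'a::real_inner set"
  assumes "bounded D"
  shows "bdd_above ((\<lambda>x. x \<bullet> u) ` D)" "bdd_below ((\<lambda>x. x \<bullet> u) ` D)"
  using bounded_linear_image[OF assms bounded_linear_inner_left]
  by (auto intro: bounded_imp_bdd_above bounded_imp_bdd_below)

lemma inner_diff_le_width:
  assumes "bounded D" "x \<in> D" "y \<in> D"
  shows "(x - y) \<bullet> u \<le> width D u"
proof -
  have "x \<bullet> u \<le> (SUP x\<in>D. x \<bullet> u)" "(INF x\<in>D. x \<bullet> u) \<le> y \<bullet> u"
    using assms by (auto intro: cSUP_upper cINF_lower bounded_imp_bdd_inner)
  then show ?thesis by (simp add: width_def inner_diff_left)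
qed

lemma width_least:
  assumes "D \<noteq> {}" "\<And>x y. x \<in> D \<Longrightarrow> y \<in> D \<Longrightarrow> (x - y) \<bullet> u \<le> B"
  shows "width D u \<le> B"
proof -
  have "x \<bullet> u - B \<le> (INF y\<in>D. y \<bullet> u)" if "x \<in> D" for x
    using assms that by (intro cINF_greatest) (auto simp: inner_diff_left algebra_simps)
  then have "(SUP x\<in>D. x \<bullet> u) \<le> B + (INF y\<in>D. y \<bullet> u)"
    using assms(1) by (intro cSUP_least) (auto simp: algebra_simps)
  then show ?thesis by (simp add: width_def)
qed

lemma width_lipschitz:
  assumes "bounded D" "D \<noteq> {}"
  shows "(diameter D)-lipschitz_on UNIV (width D)"
proof (rule lipschitz_onI)
  have "width D u \<le> width D v + diameter D * dist u v" for u v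
  proof (rule width_least[OF assms(2)])
    fix x y assume xy: "x \<in> D" "y \<in> D"
    have "(x - y) \<bullet> u = (x - y) \<bullet> v + (x - y) \<bullet> (u - v)"
      by (simp add: inner_diff_right)
    also have "\<dots> \<le> width D v + norm (x - y) * norm (u - v)"
      by (intro add_mono inner_diff_le_width norm_cauchy_schwarz assms xy)
    also have "\<dots> \<le> width D v + diameter D * dist u v"
      using diameter_bounded_bound[OF assms(1) xy] by (simp add: dist_norm mult_right_mono)
    finally show "(x - y) \<bullet> u \<le> width D v + diameter D * dist u v" .
  qed
  from this[of u v for u v] this[of v u for u v]
  show "dist (width D u) (width D v) \<le> diameter D * dist u v" for u v
    unfolding dist_real_def by (smt (verit) dist_commute)
qed (rule diameter_ge_0[OF assms(1)])

lemma width_has_integral: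
  assumes "bounded D" "D \<noteq> {}"
  shows "((\<lambda>t. width D (cis t)) has_integral 2 * pi * mean_width D) {0..2*pi}"
proof -
  have "continuous_on {0..2*pi} (\<lambda>t. width D (cis t))"
    using lipschitz_on_continuous_on[OF width_lipschitz[OF assms]]
    by (rule continuous_on_compose2) (auto intro: continuous_intros)
  from integrable_integral[OF integrable_continuous_interval[OF this]]
  show ?thesis by (simp add: mean_width_def)
qed

section \<open>Averages over the circle\<close>

lemma has_integral_periodic:
  fixes f :: "real \<Rightarrow> 'a::banach"
  assumes periodic: "\<And>x. f (x + p) = f x" and p: "p > 0" and I: "(f has_integral I) {a..a+p}"
  shows "(f has_integral I) {b..b+p}"
proof -
  interpret periodic_fun_simple f p by unfold_locales (rule periodic)
  define k where "k = \<lfloor>(b - a) / p\<rfloor>"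
  define c where "c = b - of_int k * p"
  have "of_int k \<le> (b - a) / p" "(b - a) / p < of_int k + 1"
    unfolding k_def by linarith+
  then have c: "a \<le> c" "c \<le> a + p" using p by (auto simp: c_def field_simps)
  have "f integrable_on {a..c}" "f integrable_on {c..a+p}"
    using integrable_subinterval_real[OF has_integral_integrable[OF I]] c by auto
  then obtain A C where A: "(f has_integral A) {a..c}" and C: "(f has_integral C) {c..a+p}"
    by (auto simp: integrable_on_def)
  have "(f has_integral A) {a+p..c+p}"
    using has_integral_shift_real_ivl[OF A, of "- p"] by (simp add: minus_1)
  from has_integral_combine[OF _ _ C this] have "(f has_integral C + A) {c..c+p}"
    using c by simp
  moreover have "C + A = I"
    using has_integral_combine[OF c A C] I by (simp add: has_integral_unique add.commute)
  ultimately have "(f has_integral I) {c..c+p}" by simp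
  from has_integral_shift_real_ivl[OF this, of "- (of_int k * p)"]
  show ?thesis by (simp add: minus_of_int c_def)
qed

lemma abs_cos_has_integral: "((\<lambda>t. \<bar>cos (t - \<alpha>)\<bar>) has_integral 4) {0..2*pi}"
proof -
  have FTC: "(cos has_integral sin b - sin a) {a..b}" if "a \<le> b" for a b :: real
    using that by (intro fundamental_theorem_of_calculus)
      (auto intro!: derivative_eq_intros simp flip: has_real_derivative_iff_has_vector_derivative)
  have "((\<lambda>t. \<bar>cos t\<bar>) has_integral 1 - (- 1)) {-(pi/2)..pi/2}"
  proof (rule has_integral_eq)
    show "(cos has_integral 1 - (- 1)) {-(pi/2)..pi/2}" using FTC[of "-(pi/2)" "pi/2"] by simp
  qed (auto simp: cos_ge_zero)
  moreover have "((\<lambda>t. \<bar>cos t\<bar>) has_integral - (- 1 - 1)) {pi/2..-(pi/2) + 2*pi}"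
  proof (rule has_integral_eq)
    show "((\<lambda>t. - cos t) has_integral - (- 1 - 1)) {pi/2..-(pi/2) + 2*pi}"
      using has_integral_neg[OF FTC[of "pi/2" "-(pi/2) + 2*pi", unfolded sin_periodic]] by simp
    show "- cos t = \<bar>cos t\<bar>" if "t \<in> {pi/2..-(pi/2) + 2*pi}" for t
      using that cos_ge_zero[of "t - pi"] by auto
  qed
  ultimately have "((\<lambda>t. \<bar>cos t\<bar>) has_integral 1 - (- 1) + - (- 1 - 1)) {-(pi/2)..-(pi/2) + 2*pi}"
    by (rule has_integral_combine[rotated 2]) auto
  then have "((\<lambda>t. \<bar>cos t\<bar>) has_integral 4) {-(pi/2)..-(pi/2) + 2*pi}" by simp
  then have "((\<lambda>t. \<bar>cos t\<bar>) has_integral 4) {- \<alpha>..- \<alpha> + 2*pi}"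
    by (rule has_integral_periodic[rotated 2]) auto
  from has_integral_shift_real_ivl[OF this, of "- \<alpha>"] show ?thesis by simp
qed

lemma abs_inner_cis_has_integral:
  "((\<lambda>t. \<bar>v \<bullet> cis t\<bar>) has_integral 4 * norm v) {0..2*pi}"
proof -
  have "Re v = norm v * cos (Arg v)" "Im v = norm v * sin (Arg v)"
    by (metis Re_rcis rcis_cmod_Arg, metis Im_rcis rcis_cmod_Arg)
  then have "v \<bullet> cis t = norm v * cos (t - Arg v)" for t
    by (simp add: inner_complex_def cos_diff algebra_simps)
  then have "\<bar>v \<bullet> cis t\<bar> = norm v * \<bar>cos (t - Arg v)\<bar>" for t
    by (simp add: abs_mult)
  then show ?thesis
    using has_integral_mult_right[OF abs_cos_has_integral, of "norm v" "Arg v"]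
    by (simp add: mult.commute)
qed

lemma holomorphic_fourier_coefficients:
  fixes k :: "complex \<Rightarrow> complex"
  assumes "k holomorphic_on cball 0 1"
  shows "((\<lambda>t. k (cis t) * cnj (cis t)) has_integral 2 * pi * deriv k 0) {0..2*pi}"
    and "((\<lambda>t. k (cis t) * cis t) has_integral 0) {0..2*pi}"
proof -
  have circle: "(f has_contour_integral I) (circlepath 0 1) \<longleftrightarrow>
      ((\<lambda>t. f (cis t) * \<i> * cis t) has_integral I) {0..2*pi}" for f I
    using has_contour_integral_part_circlepath_iff[of 0 "2 * pi" f I 0 1]
    by (simp add: circlepath_def)
  have "((\<lambda>u. k u / (u - 0) ^ Suc 1) has_contour_integral (2 * pi * \<i>) / fact 1 * (deriv ^^ 1) k 0)
      (circlepath 0 1)"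
    by (rule Cauchy_has_contour_integral_higher_derivative_circlepath)
      (auto intro: holomorphic_on_imp_continuous_on holomorphic_on_subset[OF assms] assms)
  then have "((\<lambda>t. k (cis t) / cis t ^ 2 * \<i> * cis t)
      has_integral 2 * pi * \<i> * deriv k 0) {0..2*pi}"
    by (simp add: circle power2_eq_square)
  from has_integral_mult_right[OF this, of "- \<i>"]
  show "((\<lambda>t. k (cis t) * cnj (cis t)) has_integral 2 * pi * deriv k 0) {0..2*pi}"
    by (simp add: cis_cnj power2_eq_square field_simps flip: cis_inverse)
  have "(k has_contour_integral 0) (circlepath 0 1)"
    by (rule Cauchy_theorem_convex_simple[OF assms]) auto
  then have "((\<lambda>t. k (cis t) * \<i> * cis t) has_integral 0) {0..2*pi}"
    by (simp add: circle)
  from has_integral_mult_right[OF this, of "- \<i>"]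
  show "((\<lambda>t. k (cis t) * cis t) has_integral 0) {0..2*pi}" by (simp add: mult_ac)
qed

lemma harmonic_fourier_coefficient:
  fixes h g :: "complex \<Rightarrow> complex"
  assumes h: "h holomorphic_on ball a r" and g: "g holomorphic_on ball a r" and s: "norm s < r"
  shows "((\<lambda>t. (h (a + s * cis t) + cnj (g (a + s * cis t))) * cnj (cis t))
    has_integral 2 * pi * (s * deriv h a)) {0..2*pi}"
proof -
  let ?T = "\<lambda>z. a + s * z"
  have "norm (s * z) < r" if "norm z \<le> 1" for z
    using mult_left_le[OF that, of "norm s"] s by (simp add: norm_mult)
  then have T: "?T ` cball 0 1 \<subseteq> ball a r" by (auto simp: dist_norm)
  have affine: "?T holomorphic_on cball 0 1" by (intro holomorphic_intros)
  have hol: "(h \<circ> ?T) holomorphic_on cball 0 1" "(g \<circ> ?T) holomorphic_on cball 0 1"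
    by (rule holomorphic_on_compose_gen[OF affine _ T], fact)+
  have "(h has_field_derivative deriv h a) (at (?T 0))"
    using holomorphic_derivI[OF h open_ball] le_less_trans[OF norm_ge_zero s] by simp
  then have "((h \<circ> ?T) has_field_derivative deriv h a * s) (at 0)"
    by (rule DERIV_chain) (auto intro!: derivative_eq_intros)
  then have "deriv (h \<circ> ?T) 0 = s * deriv h a"
    by (simp add: DERIV_imp_deriv mult.commute)
  then have "((\<lambda>t. h (?T (cis t)) * cnj (cis t)) has_integral 2 * pi * (s * deriv h a)) {0..2*pi}"
    using holomorphic_fourier_coefficients(1)[OF hol(1)] by simp
  moreover have "((\<lambda>t. cnj (g (?T (cis t)) * cis t)) has_integral cnj 0) {0..2*pi}"
    using holomorphic_fourier_coefficients(2)[OF hol(2)]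
    by (subst has_integral_cnj[unfolded o_def]) simp
  ultimately have "((\<lambda>t. h (?T (cis t)) * cnj (cis t) + cnj (g (?T (cis t)) * cis t))
      has_integral 2 * pi * (s * deriv h a) + cnj 0) {0..2*pi}"
    by (rule has_integral_add)
  then show ?thesis by (simp add: distrib_right)
qed

theorem norm_deriv_le_mean_width:
  assumes D: "bounded D" and r: "r > 0"
    and h: "h holomorphic_on ball a r" and g: "g holomorphic_on ball a r"
    and image: "\<And>z. z \<in> ball a r \<Longrightarrow> h z + cnj (g z) \<in> D"
  shows "r * norm (deriv h a) \<le> mean_width D / 2"
proof (rule field_le_mult_one_interval)
  fix \<theta> :: real assume \<theta>: "0 < \<theta>" "\<theta> < 1"
  define \<rho> where "\<rho> = \<theta> * r"
  define s where "s = of_real \<rho> * cnj (sgn (deriv h a))"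
  have \<rho>: "0 < \<rho>" "\<rho> < r" using \<theta> r by (simp_all add: \<rho>_def)
  have s: "norm s < r" using \<rho> by (simp add: s_def norm_mult norm_sgn)
  have s_deriv: "s * deriv h a = of_real (\<rho> * norm (deriv h a))"
    using complex_norm_square[of "deriv h a"]
    by (cases "deriv h a = 0") (simp_all add: s_def sgn_eq power2_eq_square field_simps)
  let ?f = "\<lambda>z. h z + cnj (g z)"
  have D_ne: "D \<noteq> {}" using image[of a] r by auto
  have "2 * (2 * pi * (\<rho> * norm (deriv h a))) \<le> 2 * pi * mean_width D"
  proof (rule has_integral_le[OF _ width_has_integral[OF D D_ne]])
    have "((\<lambda>t. ?f (a + s * cis t) * cnj (cis t) - ?f (a + - s * cis t) * cnj (cis t)) has_integral
        2 * pi * (s * deriv h a) - 2 * pi * (- s * deriv h a)) {0..2*pi}"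
      using s h g by (intro has_integral_diff harmonic_fourier_coefficient) auto
    from has_integral_linear[OF this bounded_linear_Re]
    show "((\<lambda>t. (?f (a + s * cis t) - ?f (a + - s * cis t)) \<bullet> cis t) has_integral
        2 * (2 * pi * (\<rho> * norm (deriv h a)))) {0..2*pi}"
      by (simp add: s_deriv o_def inner_complex_def algebra_simps)
    show "(?f (a + s * cis t) - ?f (a + - s * cis t)) \<bullet> cis t \<le> width D (cis t)" for t
      using s by (intro inner_diff_le_width D image) (simp_all add: dist_norm norm_mult)
  qed
  then show "\<theta> * (r * norm (deriv h a)) \<le> mean_width D / 2"
    by (simp add: \<rho>_def field_simps)
qed

section \<open>Variation and level sets\<close>

definition is_partition :: "real \<Rightarrow> real \<Rightarrow> nat \<Rightarrow> (nat \<Rightarrow> real) \<Rightarrow> bool" where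
  "is_partition a b n t \<longleftrightarrow> t 0 = a \<and> t n = b \<and> (\<forall>i<n. t i \<le> t (Suc i))"

lemma is_partition_mono:
  assumes "is_partition a b n t" "i \<le> j" "j \<le> n"
  shows "t i \<le> t j"
  using assms(2,3)
proof (induction j rule: dec_induct)
  case (step j)
  then have "t i \<le> t j" by simp
  also have "t j \<le> t (Suc j)" using assms(1) step.prems by (simp add: is_partition_def)
  finally show ?case .
qed simp

lemma is_partition_in_interval:
  assumes "is_partition a b n t" "i \<le> n"
  shows "t i \<in> {a..b}"
  using is_partition_mono[OF assms(1), of 0 i] is_partition_mono[OF assms(1), of i n] assms
  by (auto simp: is_partition_def)

lemma is_partition_uniform: "n > 0 \<Longrightarrow> is_partition 0 1 n (\<lambda>i. real i / real n)"
  by (simp add: is_partition_def divide_right_mono)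

lemma continuous_attains_open_segment:
  fixes U :: "real \<Rightarrow> real"
  assumes "continuous_on {a..b} U" "a \<le> b" "y \<in> open_segment (U a) (U b)"
  obtains s where "a < s" "s < b" "U s = y"
proof -
  have "y \<in> closed_segment (U a) (U b)" using assms(3) by (simp add: open_segment_def)
  then obtain s where "s \<in> {a..b}" "U s = y"
    using IVT'_closed_segment_real[of y U a b] assms(1,2) by (auto simp: closed_segment_eq_real_ivl)
  then show ?thesis
    using assms(3) that[of s] by (cases "s = a \<or> s = b") (auto simp: open_segment_def)
qed

lemma card_crossings_le_card_level:
  fixes U :: "real \<Rightarrow> real"
  assumes U: "continuous_on {a..b} U" and t: "is_partition a b n t"
    and finite: "finite {s\<in>{a<..<b}. U s = y}"
  shows "card {i\<in>{..<n}. y \<in> open_segment (U (t i)) (U (t (Suc i)))} \<le> card {s\<in>{a<..<b}. U s = y}"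
    (is "card ?J \<le> _")
proof -
  have "\<exists>s. t i < s \<and> s < t (Suc i) \<and> U s = y" if "i \<in> ?J" for i
  proof -
    have "continuous_on {t i..t (Suc i)} U"
      using is_partition_in_interval[OF t, of i] is_partition_in_interval[OF t, of "Suc i"] that
      by (intro continuous_on_subset[OF U]) auto
    moreover have "t i \<le> t (Suc i)" using t that by (simp add: is_partition_def)
    ultimately show ?thesis
      using continuous_attains_open_segment[of "t i" "t (Suc i)" U y] that by blast
  qed
  then obtain \<tau> where \<tau>: "\<And>i. i \<in> ?J \<Longrightarrow> t i < \<tau> i \<and> \<tau> i < t (Suc i) \<and> U (\<tau> i) = y"
    by metis
  have "\<tau> i < \<tau> j" if "i \<in> ?J" "j \<in> ?J" "i < j" for i j
    using \<tau>[OF that(1)] \<tau>[OF that(2)] is_partition_mono[OF t, of "Suc i" j] that by auto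
  then have "inj_on \<tau> ?J"
    by (intro strict_mono_on_imp_inj_on strict_mono_onI)
  moreover have "\<tau> ` ?J \<subseteq> {s\<in>{a<..<b}. U s = y}"
  proof (rule image_subsetI)
    fix i assume i: "i \<in> ?J"
    then show "\<tau> i \<in> {s\<in>{a<..<b}. U s = y}"
      using \<tau>[OF i] is_partition_in_interval[OF t, of i] is_partition_in_interval[OF t, of "Suc i"]
      by auto
  qed
  ultimately show ?thesis using finite by (rule card_inj_on_le)
qed

lemma indicator_open_segment_has_bochner_integral:
  fixes x y :: real
  shows "has_bochner_integral lborel (indicat_real (open_segment x y)) \<bar>y - x\<bar>"
proof -
  have "open_segment x y = {min x y<..<max x y}" by (simp add: open_segment_eq_real_ivl)
  then show ?thesis by (auto simp: has_bochner_integral_iff integrable_indicator_iff)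
qed

text \<open>Banach's indicatrix: integrate the number of crossings of the level \<open>y\<close> over \<open>y\<close>.\<close>

lemma variation_le_of_card_level_le:
  fixes U :: "real \<Rightarrow> real"
  assumes U: "continuous_on {a..b} U" "U ` {a..b} \<subseteq> {c..d}" "c \<le> d"
    and level: "\<And>y. y \<in> {c<..<d} \<Longrightarrow> finite {s\<in>{a<..<b}. U s = y} \<and> card {s\<in>{a<..<b}. U s = y} \<le> k"
    and t: "is_partition a b n t"
  shows "(\<Sum>i<n. \<bar>U (t (Suc i)) - U (t i)\<bar>) \<le> k * (d - c)"
proof -
  define I where "I i = open_segment (U (t i)) (U (t (Suc i)))" for i
  have I_subset: "I i \<subseteq> {c<..<d}" if "i < n" for i
  proof -
    have "t i \<in> {a..b}" "t (Suc i) \<in> {a..b}"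
      using that is_partition_in_interval[OF t] by (simp_all add: Suc_leI)
    then have "U (t i) \<in> {c..d}" "U (t (Suc i)) \<in> {c..d}" using U(2) by blast+
    then show ?thesis by (auto simp: I_def open_segment_eq_real_ivl)
  qed
  have crossings: "(\<Sum>i<n. indicat_real (I i) y) \<le> k * indicat_real {c<..<d} y" for y
  proof (cases "y \<in> {c<..<d}")
    case True
    have "(\<Sum>i<n. indicat_real (I i) y) = card {i\<in>{..<n}. y \<in> I i}"
      by (simp add: indicator_def sum.If_cases Int_def)
    also have "card {i\<in>{..<n}. y \<in> I i} \<le> k"
      using card_crossings_le_card_level[OF U(1) t, of y] level[OF True]
      unfolding I_def by linarith
    finally show ?thesis using True by simp
  next
    case False
    then have "indicat_real (I i) y = 0" if "i < n" for i
      using I_subset[OF that] by (auto simp: indicator_def)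
    then show ?thesis by (simp add: sum_nonneg)
  qed
  have sum: "has_bochner_integral lborel (\<lambda>y. \<Sum>i<n. indicat_real (I i) y)
      (\<Sum>i<n. \<bar>U (t (Suc i)) - U (t i)\<bar>)"
    unfolding I_def by (intro has_bochner_integral_sum indicator_open_segment_has_bochner_integral)
  have bound: "has_bochner_integral lborel (\<lambda>y. k * indicat_real {c<..<d} y) (k * (d - c))"
    using U(3) by (auto simp: has_bochner_integral_iff integrable_indicator_iff)
  have "(\<Sum>i<n. \<bar>U (t (Suc i)) - U (t i)\<bar>) = (\<integral>y. (\<Sum>i<n. indicat_real (I i) y) \<partial>lborel)"
    by (rule has_bochner_integral_integral_eq[OF sum, symmetric])
  also have "\<dots> \<le> (\<integral>y. k * indicat_real {c<..<d} y \<partial>lborel)"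
    by (intro integral_mono crossings integrable.intros[OF sum] integrable.intros[OF bound])
  also have "\<dots> = k * (d - c)"
    by (rule has_bochner_integral_integral_eq[OF bound])
  finally show ?thesis .
qed

section \<open>The frontier of a convex set\<close>

lemma inj_on_radial_projection_frontier:
  fixes D :: "'a::euclidean_space set"
  assumes D: "convex D" and q: "q \<in> interior D"
  shows "inj_on (\<lambda>x. sgn (x - q)) (frontier D)"
proof (rule inj_onI)
  have polar: "x - q = norm (x - q) *\<^sub>R sgn (x - q)" for x
    by (cases "x = q") (simp_all add: sgn_div_norm)
  have radius_le: "norm (y - q) \<le> norm (x - q)"
    if x: "x \<in> frontier D" and y: "y \<in> frontier D" and sgn: "sgn (x - q) = sgn (y - q)" for x y
  proof (rule ccontr)
    assume "\<not> norm (y - q) \<le> norm (x - q)"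
    then have less: "norm (x - q) < norm (y - q)" by simp
    define r where "r = norm (x - q) / norm (y - q)"
    have "x \<noteq> q" "y \<noteq> q" using x y q by (auto simp: frontier_def)
    then have "0 < r" "r < 1" using less by (simp_all add: r_def)
    moreover have "x - q = r *\<^sub>R (y - q)"
      using less by (subst (1 2) polar) (simp add: r_def sgn)
    then have "x = (1 - r) *\<^sub>R q + r *\<^sub>R y" by (simp add: algebra_simps)
    ultimately have "x \<in> open_segment q y" using less by (auto simp: in_segment)
    then show False
      using in_interior_closure_convex_segment[OF D q, of y] x y by (auto simp: frontier_def)
  qed
  fix x y assume "x \<in> frontier D" "y \<in> frontier D" "sgn (x - q) = sgn (y - q)"
  then show "x = y" using radius_le[of x y] radius_le[of y x] polar[of x] polar[of y] by simp
qed

lemma complex_inner_eq_0_imp_scaleR: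
  fixes u v :: complex
  assumes "v \<bullet> u = 0" "u \<noteq> 0"
  shows "v = Im (v / u) *\<^sub>R (\<i> * u)"
proof -
  have "Re (v / u) = 0"
    using assms(1) by (simp add: Re_complex_div_eq_0 inner_complex_def)
  then have "v / u = \<i> * of_real (Im (v / u))" by (simp add: complex_eq_iff)
  then have "v = \<i> * of_real (Im (v / u)) * u" using assms(2) by (metis nonzero_eq_divide_eq)
  then show ?thesis by (simp add: scaleR_conv_of_real mult_ac)
qed

lemma card_frontier_Int_line_le_2:
  fixes D :: "complex set"
  assumes D: "convex D" "q \<in> interior D" and u: "u \<noteq> 0"
  shows "finite {x \<in> frontier D. x \<bullet> u = q \<bullet> u}" "card {x \<in> frontier D. x \<bullet> u = q \<bullet> u} \<le> 2"
proof -
  let ?X = "{x \<in> frontier D. x \<bullet> u = q \<bullet> u}" and ?E = "{sgn (\<i> * u), - sgn (\<i> * u)}"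
  have inj: "inj_on (\<lambda>x. sgn (x - q)) ?X"
    by (rule inj_on_subset[OF inj_on_radial_projection_frontier[OF D]]) auto
  have image: "(\<lambda>x. sgn (x - q)) ` ?X \<subseteq> ?E"
  proof (rule image_subsetI)
    fix x assume x: "x \<in> ?X"
    then have "(x - q) \<bullet> u = 0" by (simp add: inner_diff_left)
    define s where "s = Im ((x - q) / u)"
    have x_q: "x - q = s *\<^sub>R (\<i> * u)"
      unfolding s_def by (rule complex_inner_eq_0_imp_scaleR) fact+
    moreover have "x \<noteq> q" using x D(2) by (auto simp: frontier_def)
    ultimately have "s \<noteq> 0" by auto
    then show "sgn (x - q) \<in> ?E"
      unfolding x_q sgn_scaleR by (simp add: sgn_real_def)
  qed
  show "finite ?X" using inj_on_finite[OF inj image] by simp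
  have "card ?X \<le> card ?E" by (rule card_inj_on_le[OF inj image]) simp
  also have "\<dots> \<le> 2" by (rule order_trans[OF card_insert_le_m1]) auto
  finally show "card ?X \<le> 2" .
qed

lemma inner_frontier_bounds:
  fixes D :: "'a::real_inner set"
  assumes "bounded D" "x \<in> frontier D"
  shows "x \<bullet> u \<in> {(INF y\<in>D. y \<bullet> u)..(SUP y\<in>D. y \<bullet> u)}"
proof -
  have "D \<subseteq> {y. (INF y\<in>D. y \<bullet> u) \<le> u \<bullet> y} \<inter> {y. u \<bullet> y \<le> (SUP y\<in>D. y \<bullet> u)}"
    using assms(1)
    by (auto simp: inner_commute[of u] intro: cSUP_upper cINF_lower bounded_imp_bdd_inner)
  then have "closure D \<subseteq> {y. (INF y\<in>D. y \<bullet> u) \<le> u \<bullet> y} \<inter> {y. u \<bullet> y \<le> (SUP y\<in>D. y \<bullet> u)}"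
    by (intro closure_minimal closed_Int closed_halfspace_ge closed_halfspace_le)
  then show ?thesis using assms(2) by (auto simp: frontier_def inner_commute[of u])
qed

lemma connected_inner_between:
  fixes D :: "'a::euclidean_space set"
  assumes D: "connected D" "bounded D" "D \<noteq> {}"
    and y: "y \<in> {(INF x\<in>D. x \<bullet> u)<..<(SUP x\<in>D. x \<bullet> u)}"
  obtains q where "q \<in> D" "q \<bullet> u = y"
proof -
  obtain a b where "a \<in> D" "a \<bullet> u < y" "b \<in> D" "y < b \<bullet> u"
    using y D(3) bounded_imp_bdd_inner[OF D(2), of u] by (auto simp: cINF_less_iff less_cSUP_iff)
  then show ?thesis
    using connected_ivt_hyperplane[OF D(1), of a b u y] that by (auto simp: inner_commute[of u])
qed

lemma frontier_loop_variation_le_width: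
  fixes D :: "complex set"
  assumes D: "open D" "convex D" "bounded D" "D \<noteq> {}"
    and g: "simple_path g" "path_image g = frontier D" and t: "is_partition 0 1 n t" and u: "u \<noteq> 0"
  shows "(\<Sum>i<n. \<bar>(g (t (Suc i)) - g (t i)) \<bullet> u\<bar>) \<le> 2 * width D u"
proof -
  let ?c = "INF x\<in>D. x \<bullet> u" and ?d = "SUP x\<in>D. x \<bullet> u"
  have frontier: "g s \<in> frontier D" if "s \<in> {0..1}" for s
    using g(2) that by (auto simp: path_image_def)
  have "(\<Sum>i<n. \<bar>g (t (Suc i)) \<bullet> u - g (t i) \<bullet> u\<bar>) \<le> real 2 * (?d - ?c)"
  proof (rule variation_le_of_card_level_le[where U = "\<lambda>s. g s \<bullet> u", OF _ _ _ _ t])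
    show "continuous_on {0..1} (\<lambda>s. g s \<bullet> u)"
      using simple_path_imp_path[OF g(1)] by (auto simp: path_def intro: continuous_intros)
    show image: "(\<lambda>s. g s \<bullet> u) ` {0..1} \<subseteq> {?c..?d}"
      using inner_frontier_bounds[OF D(3) frontier] by blast
    then show "?c \<le> ?d" by force
    fix y assume "y \<in> {?c<..<?d}"
    then obtain q where q: "q \<in> D" "q \<bullet> u = y"
      using connected_inner_between[OF convex_connected[OF D(2)] D(3,4)] by blast
    then have "q \<in> interior D" using D(1) by (simp add: interior_open)
    note line = card_frontier_Int_line_le_2[OF D(2) this u]
    have inj: "inj_on g {s\<in>{0<..<1}. g s \<bullet> u = y}"
      by (rule inj_on_subset[OF simple_path_inj_on[OF g(1)]]) auto
    have image: "g ` {s\<in>{0<..<1}. g s \<bullet> u = y} \<subseteq> {x \<in> frontier D. x \<bullet> u = q \<bullet> u}"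
      using frontier q by auto
    show "finite {s\<in>{0<..<1}. g s \<bullet> u = y} \<and> card {s\<in>{0<..<1}. g s \<bullet> u = y} \<le> 2"
      using inj_on_finite[OF inj image line(1)] card_inj_on_le[OF inj image line(1)] line(2) by simp
  qed
  then show ?thesis by (simp add: inner_diff_left width_def)
qed

section \<open>Cauchy's formula\<close>

lemma path_uniform_points_dense:
  fixes g :: "real \<Rightarrow> 'a::metric_space"
  assumes "path g" "e > 0"
  obtains n where "n > 0" "\<And>z. z \<in> path_image g \<Longrightarrow> \<exists>j\<le>n. dist (g (real j / real n)) z < e"
proof -
  have "uniformly_continuous_on {0..1} g"
    using assms(1) by (auto simp: path_def intro: compact_uniformly_continuous)
  then obtain d where d: "d > 0"
    "\<And>s t. \<lbrakk>s \<in> {0..1}; t \<in> {0..1}; dist t s < d\<rbrakk> \<Longrightarrow> dist (g t) (g s) < e"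
    unfolding uniformly_continuous_on_def using assms(2) by metis
  obtain n where n: "n > 0" "1 / real n < d" using d(1) by (metis nat_approx_posE zero_less_Suc)
  show ?thesis
  proof (rule that[OF n(1)])
    fix z assume "z \<in> path_image g"
    then obtain s where s: "s \<in> {0..1}" "z = g s" by (auto simp: path_image_def)
    define j where "j = nat \<lfloor>s * real n\<rfloor>"
    have j: "real j \<le> s * real n" "s * real n < real j + 1"
      using s(1) by (auto simp: j_def)
    have "s * real n \<le> real n" using s(1) n(1) by simp
    then have "j \<le> n" using j(1) by linarith
    moreover have "real j / real n \<le> s" "s \<le> real j / real n + 1 / real n"
      using j n(1) by (simp_all add: field_simps)
    then have "dist (real j / real n) s < d" using n(2) by (simp add: dist_real_def)
    ultimately show "\<exists>j\<le>n. dist (g (real j / real n)) z < e"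
      using d(2)[OF s(1), of "real j / real n"] n(1) s(2) by auto
  qed
qed

lemma closed_sequence_variation_ge:
  fixes v :: "nat \<Rightarrow> real"
  assumes "v n = v 0" "j \<le> n" "k \<le> n"
  shows "2 * \<bar>v j - v k\<bar> \<le> (\<Sum>i<n. \<bar>v (Suc i) - v i\<bar>)"
  using assms(2,3)
proof (induction j k rule: linorder_wlog)
  case (le j k)
  have segment: "\<bar>v b - v a\<bar> \<le> (\<Sum>i=a..<b. \<bar>v (Suc i) - v i\<bar>)" if "a \<le> b" for a b
    using sum_abs[of "\<lambda>i. v (Suc i) - v i" "{a..<b}"] sum_Suc_diff'[OF that, of v] by simp
  have "2 * \<bar>v j - v k\<bar> \<le> \<bar>v j - v 0\<bar> + \<bar>v k - v j\<bar> + \<bar>v n - v k\<bar>"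
    using abs_triangle_ineq[of "v j - v 0" "v n - v k"] by (simp add: assms(1) abs_minus_commute)
  also have "\<dots> \<le> (\<Sum>i=0..<j. \<bar>v (Suc i) - v i\<bar>) + (\<Sum>i=j..<k. \<bar>v (Suc i) - v i\<bar>)
      + (\<Sum>i=k..<n. \<bar>v (Suc i) - v i\<bar>)"
    by (intro add_mono segment le le0)
  also have "\<dots> = (\<Sum>i<n. \<bar>v (Suc i) - v i\<bar>)"
    using le by (simp add: sum.atLeastLessThan_concat lessThan_atLeast0)
  finally show ?case .
next
  case (sym j k)
  then show ?case by (simp add: abs_minus_commute)
qed

lemma frontier_inner_ge:
  fixes D :: "'a::euclidean_space set"
  assumes "bounded D" "x \<in> interior D" "u \<noteq> 0"
  obtains z where "z \<in> frontier D" "x \<bullet> u \<le> z \<bullet> u"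
proof -
  obtain d where "d > 0" "x + d *\<^sub>R u \<in> frontier D" using ray_to_frontier[OF assms] by blast
  moreover from this(1) have "x \<bullet> u \<le> (x + d *\<^sub>R u) \<bullet> u" by (simp add: inner_add_left)
  ultimately show ?thesis using that by blast
qed

lemma uniform_points_nearly_support:
  fixes D :: "'a::euclidean_space set"
  assumes D: "open D" "bounded D" and g: "path g" "path_image g = frontier D" and e: "e > 0"
  obtains n where "n > 0"
    "\<And>u x. \<lbrakk>norm u = 1; x \<in> D\<rbrakk> \<Longrightarrow> \<exists>j\<le>n. x \<bullet> u \<le> g (real j / real n) \<bullet> u + e"
proof -
  obtain n where n: "n > 0"
    and near: "\<And>z. z \<in> frontier D \<Longrightarrow> \<exists>j\<le>n. dist (g (real j / real n)) z < e"
    using path_uniform_points_dense[OF g(1) e] g(2) by metis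
  show ?thesis
  proof (rule that[OF n])
    fix u x :: 'a assume u: "norm u = 1" and x: "x \<in> D"
    have "x \<in> interior D" "u \<noteq> 0" using x D(1) u by (auto simp: interior_open)
    then obtain z where z: "z \<in> frontier D" "x \<bullet> u \<le> z \<bullet> u" by (rule frontier_inner_ge[OF D(2)])
    obtain j where j: "j \<le> n" "norm (g (real j / real n) - z) < e"
      using near[OF z(1)] by (auto simp: dist_norm)
    have "(z - g (real j / real n)) \<bullet> u \<le> norm (g (real j / real n) - z)"
      using norm_cauchy_schwarz[of "z - g (real j / real n)" u] u by (simp add: norm_minus_commute)
    then show "\<exists>j\<le>n. x \<bullet> u \<le> g (real j / real n) \<bullet> u + e"
      using j z(2) by (intro exI[of _ j]) (simp add: inner_diff_left)
  qed
qed

lemma width_le_loop_variation: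
  fixes D :: "'a::euclidean_space set"
  assumes D: "open D" "bounded D" "D \<noteq> {}"
    and g: "path g" "pathstart g = pathfinish g" "path_image g = frontier D" and e: "e > 0"
  obtains n t where "is_partition 0 1 n t"
    "\<And>u. norm u = 1 \<Longrightarrow> width D u \<le> (\<Sum>i<n. \<bar>(g (t (Suc i)) - g (t i)) \<bullet> u\<bar>) / 2 + e"
proof -
  obtain n where n: "n > 0" and support:
    "\<And>u x. \<lbrakk>norm u = 1; x \<in> D\<rbrakk> \<Longrightarrow> \<exists>j\<le>n. x \<bullet> u \<le> g (real j / real n) \<bullet> u + e / 2"
    using uniform_points_nearly_support[OF D(1,2) g(1,3) half_gt_zero[OF e]] by blast
  define t where "t i = real i / real n" for i
  have closed: "g (t n) = g (t 0)"
    using g(2) n by (simp add: t_def pathstart_def pathfinish_def)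
  show ?thesis
  proof (rule that)
    show "is_partition 0 1 n t" unfolding t_def using n by (rule is_partition_uniform)
    fix u :: 'a assume u: "norm u = 1"
    define V where "V = (\<Sum>i<n. \<bar>(g (t (Suc i)) - g (t i)) \<bullet> u\<bar>)"
    have "width D u \<le> V / 2 + e"
    proof (rule width_least[OF D(3)])
      fix x y assume "x \<in> D" "y \<in> D"
      then obtain j k where j: "j \<le> n" "x \<bullet> u \<le> g (t j) \<bullet> u + e / 2"
        and k: "k \<le> n" "y \<bullet> - u \<le> g (t k) \<bullet> - u + e / 2"
        using support[of u x] support[of "- u" y] u unfolding t_def by auto
      have "2 * \<bar>g (t j) \<bullet> u - g (t k) \<bullet> u\<bar> \<le> V"
        unfolding V_def inner_diff_left using closed j(1) k(1)
        by (intro closed_sequence_variation_ge[of "\<lambda>i. g (t i) \<bullet> u"]) simp_all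
      then show "(x - y) \<bullet> u \<le> V / 2 + e"
        using j(2) k(2) unfolding inner_diff_left inner_minus_right by argo
    qed
    then show "width D u \<le> (\<Sum>i<n. \<bar>(g (t (Suc i)) - g (t i)) \<bullet> u\<bar>) / 2 + e"
      unfolding V_def .
  qed
qed

lemma sum_abs_inner_cis_has_integral:
  assumes "finite A"
  shows "((\<lambda>t. \<Sum>i\<in>A. \<bar>v i \<bullet> cis t\<bar>) has_integral 4 * (\<Sum>i\<in>A. norm (v i))) {0..2*pi}"
  unfolding sum_distrib_left
  by (intro has_integral_sum assms abs_inner_cis_has_integral)

lemma curve_length_eq_Sup_partitions:
  "curve_length g = Sup {\<Sum>i<n. norm (g (t (Suc i)) - g (t i)) | n t. is_partition 0 1 n t}"
  by (simp add: curve_length_def is_partition_def)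

text \<open>This bound also shows that the supremum in \<^const>\<open>curve_length\<close> is not a junk value.\<close>

lemma inscribed_polygon_length_le:
  fixes D :: "complex set"
  assumes D: "open D" "convex D" "bounded D" "D \<noteq> {}"
    and g: "simple_path g" "path_image g = frontier D" and t: "is_partition 0 1 n t"
  shows "(\<Sum>i<n. norm (g (t (Suc i)) - g (t i))) \<le> pi * mean_width D"
proof -
  have "4 * (\<Sum>i<n. norm (g (t (Suc i)) - g (t i))) \<le> 2 * (2 * pi * mean_width D)"
    using sum_abs_inner_cis_has_integral[OF finite_lessThan]
      has_integral_mult_right[OF width_has_integral[OF D(3,4)], of 2]
    by (rule has_integral_le) (simp add: frontier_loop_variation_le_width[OF D g t])
  then show ?thesis by simp
qed

lemma inscribed_polygon_length_ge:
  fixes D :: "complex set"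
  assumes D: "open D" "bounded D" "D \<noteq> {}"
    and g: "path g" "pathstart g = pathfinish g" "path_image g = frontier D" and e: "e > 0"
  obtains n t where "is_partition 0 1 n t"
    "pi * mean_width D \<le> (\<Sum>i<n. norm (g (t (Suc i)) - g (t i))) + e"
proof -
  have "e / pi > 0" using e by simp
  then obtain n t where t: "is_partition 0 1 n t" and width: "\<And>u. norm u = 1 \<Longrightarrow>
      width D u \<le> (\<Sum>i<n. \<bar>(g (t (Suc i)) - g (t i)) \<bullet> u\<bar>) / 2 + e / pi"
    using width_le_loop_variation[OF D g] by metis
  let ?L = "\<Sum>i<n. norm (g (t (Suc i)) - g (t i))"
  have "((\<lambda>s. (\<Sum>i<n. \<bar>(g (t (Suc i)) - g (t i)) \<bullet> cis s\<bar>) / 2 + e / pi) has_integral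
      4 * ?L / 2 + (2 * pi - 0) *\<^sub>R (e / pi)) {0..2*pi}"
    using has_integral_const_real[of "e / pi" 0 "2 * pi"]
    by (intro has_integral_add has_integral_divide sum_abs_inner_cis_has_integral) simp_all
  with width_has_integral[OF D(2,3)]
  have "2 * pi * mean_width D \<le> 4 * ?L / 2 + (2 * pi - 0) *\<^sub>R (e / pi)"
    by (rule has_integral_le) (simp add: width)
  then have "pi * mean_width D \<le> ?L + e" by simp
  then show ?thesis by (rule that[OF t])
qed

lemma curve_length_frontier_loop:
  fixes D :: "complex set"
  assumes D: "open D" "convex D" "bounded D" "D \<noteq> {}"
    and g: "simple_path g" "pathstart g = pathfinish g" "path_image g = frontier D"
  shows "curve_length g = pi * mean_width D"
proof -
  let ?L = "\<lambda>n t. \<Sum>i<n. norm (g (t (Suc i)) - g (t i))"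
  let ?S = "{?L n t | n t. is_partition 0 1 n t}"
  have upper: "x \<le> pi * mean_width D" if "x \<in> ?S" for x
    using that inscribed_polygon_length_le[OF D g(1,3)] by blast
  show ?thesis
    unfolding curve_length_eq_Sup_partitions
  proof (rule antisym)
    have "is_partition 0 1 1 (\<lambda>i. real i / real 1)" by (rule is_partition_uniform) simp
    then have "?S \<noteq> {}" by blast
    then show "Sup ?S \<le> pi * mean_width D" by (rule cSup_least) (rule upper)
    show "pi * mean_width D \<le> Sup ?S"
    proof (rule field_le_epsilon)
      fix e :: real assume "e > 0"
      then obtain n t where "is_partition 0 1 n t" "pi * mean_width D \<le> ?L n t + e"
        using inscribed_polygon_length_ge[OF D(1,3,4) simple_path_imp_path[OF g(1)] g(2,3)] by metis
      moreover from this(1) have "?L n t \<le> Sup ?S" by (intro cSup_upper bdd_aboveI[OF upper]) auto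
      ultimately show "pi * mean_width D \<le> Sup ?S + e" by linarith
    qed
  qed
qed

lemma convex_frontier_simple_loop:
  fixes D :: "complex set"
  assumes D: "open D" "convex D" "bounded D" "D \<noteq> {}"
  obtains g where "simple_path g" "pathstart g = pathfinish g" "path_image g = frontier D"
proof -
  have "rel_frontier (ball (0::complex) 1) homeomorphic rel_frontier D"
    by (rule homeomorphic_rel_frontiers_convex_bounded_sets)
      (use D in \<open>auto simp: aff_dim_open\<close>)
  moreover have "rel_frontier (ball (0::complex) 1) = sphere 0 1" "rel_frontier D = frontier D"
    using D by (simp_all add: rel_frontier_nonempty_interior interior_open)
  ultimately obtain k k' where hom: "homeomorphism (sphere (0::complex) 1) (frontier D) k k'"
    unfolding homeomorphic_def by auto
  show ?thesis
  proof (rule that)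
    show "simple_path (k \<circ> circlepath 0 1)"
      using hom by (intro simple_path_continuous_image)
        (auto simp: simple_path_circlepath homeomorphism_def intro: inj_on_inverseI)
    show "path_image (k \<circ> circlepath 0 1) = frontier D"
      using hom by (simp add: path_image_compose homeomorphism_def)
    show "pathstart (k \<circ> circlepath 0 1) = pathfinish (k \<circ> circlepath 0 1)"
      by (simp add: pathstart_compose pathfinish_compose)
  qed
qed

theorem Cauchy_perimeter_formula:
  fixes D :: "complex set"
  assumes D: "open D" "convex D" "bounded D" "D \<noteq> {}"
  shows "perimeter D = pi * mean_width D"
  unfolding perimeter_def
proof (rule some_equality)
  obtain g where "simple_path g" "pathstart g = pathfinish g" "path_image g = frontier D"
    using convex_frontier_simple_loop[OF D] .
  then show "\<exists>g. simple_path g \<and> pathstart g = pathfinish g \<and> path_image g = frontier D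
      \<and> curve_length g = pi * mean_width D"
    using curve_length_frontier_loop[OF D] by blast
qed (use curve_length_frontier_loop[OF D] in blast)

section \<open>Normal families\<close>

lemma norm_diff_le_of_deriv_growth:
  fixes h :: "complex \<Rightarrow> complex"
  assumes h: "h holomorphic_on ball a r"
    and growth: "\<And>z. z \<in> ball a r \<Longrightarrow> (r - dist a z) * norm (deriv h z) \<le> C"
    and z: "z \<in> ball a r"
  shows "norm (h z - h a) \<le> C / (r - dist a z) * dist a z"
proof -
  have subset: "cball a (dist a z) \<subseteq> ball a r" using z by auto
  have "norm (h z - h a) \<le> C / (r - dist a z) * norm (z - a)"
  proof (rule field_differentiable_bound[of "cball a (dist a z)"])
    fix x assume x: "x \<in> cball a (dist a z)"
    then show "(h has_field_derivative deriv h x) (at x within cball a (dist a z))"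
      using subset by (intro holomorphic_derivI[OF h]) auto
    have "(r - dist a z) * norm (deriv h x) \<le> (r - dist a x) * norm (deriv h x)"
      using x by (intro mult_right_mono) auto
    also have "\<dots> \<le> C" using x subset by (intro growth) auto
    finally show "norm (deriv h x) \<le> C / (r - dist a z)"
      using z by (simp add: field_simps)
  qed auto
  then show ?thesis by (simp add: dist_norm norm_minus_commute)
qed

lemma bounded_on_compact_of_deriv_growth:
  fixes \<H> :: "(complex \<Rightarrow> complex) set"
  assumes hol: "\<And>h. h \<in> \<H> \<Longrightarrow> h holomorphic_on ball a r" and at_a: "\<And>h. h \<in> \<H> \<Longrightarrow> h a = b"
    and growth: "\<And>h z. \<lbrakk>h \<in> \<H>; z \<in> ball a r\<rbrakk> \<Longrightarrow> (r - dist a z) * norm (deriv h z) \<le> C"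
    and K: "compact K" "K \<subseteq> ball a r"
  shows "\<exists>B. \<forall>h\<in>\<H>. \<forall>z\<in>K. norm (h z) \<le> B"
proof -
  let ?b = "\<lambda>z. norm b + C / (r - dist a z) * dist a z"
  have "continuous_on K ?b"
    using K(2) by (intro continuous_intros) auto
  then have "bdd_above (?b ` K)"
    using K(1) by (intro bounded_imp_bdd_above compact_imp_bounded compact_continuous_image)
  then obtain B where B: "\<And>z. z \<in> K \<Longrightarrow> ?b z \<le> B" by (auto simp: bdd_above_def)
  have "norm (h z) \<le> B" if h: "h \<in> \<H>" and z: "z \<in> K" for h z
  proof -
    have "norm (h z) \<le> norm b + norm (h z - h a)"
      using norm_triangle_sub[of "h z" b] at_a[OF h] by simp
    also have "\<dots> \<le> ?b z"
      using norm_diff_le_of_deriv_growth[OF hol[OF h] growth[OF h]] z K(2) by auto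
    also have "\<dots> \<le> B" by (rule B[OF z])
    finally show ?thesis .
  qed
  then show ?thesis by blast
qed

lemma Montel_deriv_growth:
  fixes F :: "nat \<Rightarrow> complex \<Rightarrow> complex"
  assumes F: "\<And>n. F n holomorphic_on ball a r" "\<And>n. F n a = b"
    and growth: "\<And>n z. z \<in> ball a r \<Longrightarrow> (r - dist a z) * norm (deriv (F n) z) \<le> C"
  obtains G \<sigma> where "G holomorphic_on ball a r" "strict_mono \<sigma>"
    "\<forall>z\<in>ball a r. (\<lambda>n. F (\<sigma> n) z) \<longlonglongrightarrow> G z"
    "\<forall>z\<in>ball a r. (\<lambda>n. deriv (F (\<sigma> n)) z) \<longlonglongrightarrow> deriv G z"
proof -
  have hol: "h holomorphic_on ball a r" if "h \<in> range F" for h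
    using F(1) that by auto
  have bounded: "\<exists>B. \<forall>h\<in>range F. \<forall>z\<in>K. norm (h z) \<le> B" if "compact K" "K \<subseteq> ball a r" for K
    by (rule bounded_on_compact_of_deriv_growth[OF hol _ _ that]) (use F(2) growth in auto)
  obtain G \<sigma> where G: "G holomorphic_on ball a r" "strict_mono \<sigma>"
    and lim: "\<And>z. z \<in> ball a r \<Longrightarrow> (\<lambda>n. F (\<sigma> n) z) \<longlonglongrightarrow> G z"
    and uniform: "\<And>K. \<lbrakk>compact K; K \<subseteq> ball a r\<rbrakk> \<Longrightarrow> uniform_limit K (F \<circ> \<sigma>) G sequentially"
    by (rule Montel[OF open_ball hol bounded order_refl])
      (assumption | (rule that; blast))+
  have "(\<lambda>n. deriv (F (\<sigma> n)) z) \<longlonglongrightarrow> deriv G z" if "z \<in> ball a r" for z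
  proof -
    obtain \<epsilon> where \<epsilon>: "\<epsilon> > 0" "cball z \<epsilon> \<subseteq> ball a r"
      using \<open>z \<in> ball a r\<close> open_contains_cball by blast
    then have subset: "ball z \<epsilon> \<subseteq> ball a r" using ball_subset_cball by blast
    have "uniform_limit (ball z \<epsilon>) (F \<circ> \<sigma>) G sequentially"
      using uniform_limit_on_subset[OF uniform[OF compact_cball \<epsilon>(2)] ball_subset_cball] .
    then show ?thesis
      using holomorphic_on_subset[OF F(1) subset] \<epsilon>(1)
      by (intro deriv_complex_uniform_limit[where A = "ball z \<epsilon>"]) (auto simp: o_def)
  qed
  with G lim show ?thesis using that by blast
qed

section \<open>Extremal maps\<close>

definition harmonic_pair ::
    "complex set \<Rightarrow> complex \<Rightarrow> (complex \<Rightarrow> complex) \<Rightarrow> (complex \<Rightarrow> complex) \<Rightarrow> bool" where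
  "harmonic_pair D p h g \<longleftrightarrow> h holomorphic_on ball 0 1 \<and> g holomorphic_on ball 0 1 \<and>
     (\<forall>z\<in>ball 0 1. h z + cnj (g z) \<in> D) \<and> h 0 = p / 2 \<and> g 0 = cnj p / 2"

text \<open>The orientation reversing case reduces to this one by a reflection of the disc, which
  exchanges the roles of \<open>h\<close> and \<open>g\<close>.\<close>

definition conformal_norms :: "complex set \<Rightarrow> complex \<Rightarrow> real set" where
  "conformal_norms D p = {norm (deriv h 0) | h g. harmonic_pair D p h g \<and> deriv g 0 = 0}"

lemma conformal_normsI:
  "harmonic_pair D p h g \<Longrightarrow> deriv g 0 = 0 \<Longrightarrow> norm (deriv h 0) \<in> conformal_norms D p"
  by (auto simp: conformal_norms_def)

lemma harmonic_pair_reflect: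
  assumes "harmonic_pair D p h g"
  shows "harmonic_pair D p (cnj \<circ> g \<circ> cnj) (cnj \<circ> h \<circ> cnj)"
proof -
  have "cnj ` ball 0 1 = ball 0 1" by (force simp: image_iff intro: bexI[of _ "cnj _"])
  then show ?thesis
    using assms unfolding harmonic_pair_def
    by (auto intro!: holomorphic_on_compose_cnj_cnj simp: add.commute)
qed

lemma harmonic_pair_deriv_growth:
  assumes D: "bounded D" and hg: "harmonic_pair D p h g" and z: "z \<in> ball 0 1"
  shows "(1 - dist 0 z) * norm (deriv h z) \<le> mean_width D / 2"
    and "(1 - dist 0 z) * norm (deriv g z) \<le> mean_width (cnj ` D) / 2"
proof -
  have subset: "ball z (1 - dist 0 z) \<subseteq> ball 0 1" by (simp add: ball_subset_ball_iff dist_commute)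
  have hol: "h holomorphic_on ball z (1 - dist 0 z)" "g holomorphic_on ball z (1 - dist 0 z)"
    using hg subset by (auto simp: harmonic_pair_def intro: holomorphic_on_subset)
  have image: "h w + cnj (g w) \<in> D" if "w \<in> ball z (1 - dist 0 z)" for w
    using hg subset that by (auto simp: harmonic_pair_def)
  have "g w + cnj (h w) \<in> cnj ` D" if "w \<in> ball z (1 - dist 0 z)" for w
    using imageI[OF image[OF that], of cnj] by (simp add: add.commute)
  then show "(1 - dist 0 z) * norm (deriv g z) \<le> mean_width (cnj ` D) / 2"
    using z bounded_linear_image[OF D bounded_linear_cnj]
    by (intro norm_deriv_le_mean_width[OF _ _ hol(2,1)]) auto
  show "(1 - dist 0 z) * norm (deriv h z) \<le> mean_width D / 2"
    using z by (intro norm_deriv_le_mean_width[OF D _ hol image]) auto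
qed

lemma harmonic_pair_limit:
  assumes D: "open D" "convex D" "p \<in> D"
    and pairs: "\<And>n. harmonic_pair D p (h n) (g n)"
    and hol: "H holomorphic_on ball 0 1" "G holomorphic_on ball 0 1"
    and lim: "\<And>z. z \<in> ball 0 1 \<Longrightarrow> (\<lambda>n. h n z) \<longlonglongrightarrow> H z"
      "\<And>z. z \<in> ball 0 1 \<Longrightarrow> (\<lambda>n. g n z) \<longlonglongrightarrow> G z"
  shows "harmonic_pair D p H G"
proof -
  have at_0: "H 0 = p / 2" "G 0 = cnj p / 2"
    using LIMSEQ_unique[OF lim(1)[of 0], of "p / 2"] LIMSEQ_unique[OF lim(2)[of 0], of "cnj p / 2"]
      pairs unfolding harmonic_pair_def by simp_all
  have "H z + cnj (G z) \<in> closure D" if "z \<in> ball 0 1" for z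
  proof (rule Lim_in_closed_set[OF closed_closure _ trivial_limit_sequentially])
    show "(\<lambda>n. h n z + cnj (g n z)) \<longlonglongrightarrow> H z + cnj (G z)"
      by (intro tendsto_intros lim that)
    have "h n z + cnj (g n z) \<in> D" for n
      using pairs[of n] that by (simp add: harmonic_pair_def)
    then show "\<forall>\<^sub>F n in sequentially. h n z + cnj (g n z) \<in> closure D"
      using closure_subset by (intro always_eventually allI) blast
  qed
  from harmonic_in_closure_imp_in_open_convex[OF D(1,2) open_ball connected_ball hol this, of 0]
  have "H z + cnj (G z) \<in> D" if "z \<in> ball 0 1" for z
    using D(3) at_0 that by simp
  then show ?thesis using hol at_0 by (simp add: harmonic_pair_def)
qed

lemma harmonic_pair_sequence_compact:
  assumes D: "open D" "convex D" "bounded D" "p \<in> D"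
    and pairs: "\<And>n. harmonic_pair D p (h n) (g n)"
  obtains H G \<sigma> where "harmonic_pair D p H G" "strict_mono (\<sigma> :: nat \<Rightarrow> nat)"
    "(\<lambda>n. deriv (h (\<sigma> n)) 0) \<longlonglongrightarrow> deriv H 0" "(\<lambda>n. deriv (g (\<sigma> n)) 0) \<longlonglongrightarrow> deriv G 0"
proof -
  note growth = harmonic_pair_deriv_growth[OF D(3) pairs]
  have hol: "h n holomorphic_on ball 0 1" "g n holomorphic_on ball 0 1"
    and at_0: "h n 0 = p / 2" "g n 0 = cnj p / 2" for n
    using pairs[of n] by (simp_all add: harmonic_pair_def)
  obtain H \<sigma> where H: "H holomorphic_on ball 0 1" "strict_mono \<sigma>"
    and H_lim: "\<forall>z\<in>ball 0 1. (\<lambda>n. h (\<sigma> n) z) \<longlonglongrightarrow> H z"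
      "\<forall>z\<in>ball 0 1. (\<lambda>n. deriv (h (\<sigma> n)) z) \<longlonglongrightarrow> deriv H z"
    using Montel_deriv_growth[of h 0 1, OF hol(1) at_0(1) growth(1)] .
  obtain G \<tau> where G: "G holomorphic_on ball 0 1" "strict_mono \<tau>"
    and G_lim: "\<forall>z\<in>ball 0 1. (\<lambda>n. g (\<sigma> (\<tau> n)) z) \<longlonglongrightarrow> G z"
      "\<forall>z\<in>ball 0 1. (\<lambda>n. deriv (g (\<sigma> (\<tau> n))) z) \<longlonglongrightarrow> deriv G z"
    using Montel_deriv_growth[of "\<lambda>n. g (\<sigma> n)" 0 1, OF hol(2) at_0(2) growth(2)] .
  note H_lim_subseq = H_lim[THEN bspec, THEN LIMSEQ_subseq_LIMSEQ, OF _ G(2), unfolded o_def]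
  have "harmonic_pair D p H G"
    by (rule harmonic_pair_limit[OF D(1,2,4) pairs H(1) G(1) H_lim_subseq(1) G_lim(1)[THEN bspec]])
  then show ?thesis
    using strict_mono_o[OF H(2) G(2)] H_lim_subseq(2)[of 0] G_lim(2)
    by (intro that[of H G "\<sigma> \<circ> \<tau>"]) simp_all
qed

lemma closed_conformal_norms:
  assumes D: "open D" "convex D" "bounded D" "p \<in> D"
  shows "closed (conformal_norms D p)"
  unfolding closed_sequential_limits
proof (intro allI impI, elim conjE)
  fix x L assume "\<forall>n. x n \<in> conformal_norms D p" and x: "x \<longlonglongrightarrow> L"
  then obtain h g where pairs: "\<And>n. harmonic_pair D p (h n) (g n)"
    and hg: "\<And>n. deriv (g n) 0 = 0" "\<And>n. x n = norm (deriv (h n) 0)"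
    unfolding conformal_norms_def mem_Collect_eq by metis
  obtain H G \<sigma> where HG: "harmonic_pair D p H G" and \<sigma>: "strict_mono (\<sigma> :: nat \<Rightarrow> nat)"
    and lim: "(\<lambda>n. deriv (h (\<sigma> n)) 0) \<longlonglongrightarrow> deriv H 0" "(\<lambda>n. deriv (g (\<sigma> n)) 0) \<longlonglongrightarrow> deriv G 0"
    by (rule harmonic_pair_sequence_compact[OF D pairs])
  have "deriv G 0 = 0" using LIMSEQ_unique[OF lim(2)] by (simp add: hg(1))
  moreover have "L = norm (deriv H 0)"
    using LIMSEQ_unique[OF LIMSEQ_subseq_LIMSEQ[OF x \<sigma>]] tendsto_norm[OF lim(1)]
    by (simp add: o_def hg(2))
  ultimately show "L \<in> conformal_norms D p" using conformal_normsI[OF HG] by simp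
qed

lemma onorm_eqI_norm_multiple:
  fixes f :: "'a::{real_normed_vector, perfect_space} \<Rightarrow> 'b::real_normed_vector"
  assumes f: "bounded_linear f" and norm: "\<And>x. norm (f x) = c * norm x"
  shows "onorm f = c"
proof (rule antisym)
  show "onorm f \<le> c" by (rule onorm_le) (simp add: norm)
  have "{0::'a} \<noteq> UNIV" by (metis not_open_singleton open_UNIV)
  then obtain x :: 'a where "x \<noteq> 0" by fast
  then show "c \<le> onorm f" using le_onorm[OF f, of x] by (simp add: norm)
qed

lemma has_derivative_harmonic_pair:
  assumes "harmonic_pair D p h g"
  shows "((\<lambda>z. h z + cnj (g z)) has_derivative (\<lambda>k. deriv h 0 * k + cnj (deriv g 0 * k))) (at 0)"
  by (rule has_derivative_holomorphic_plus_cnj)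
    (use assms in \<open>auto simp: harmonic_pair_def intro!: holomorphic_derivI\<close>)

lemmas frechet_derivative_harmonic_pair =
  has_derivative_harmonic_pair[THEN frechet_derivative_at, symmetric]

lemma conformal_linear_iff:
  "conformal_linear (\<lambda>k. a * k + cnj (b * k)) \<longleftrightarrow> a = 0 \<or> b = 0"
proof
  assume "conformal_linear (\<lambda>k. a * k + cnj (b * k))"
  then obtain c where "(\<forall>k. a * k + cnj (b * k) = c * k) \<or> (\<forall>k. a * k + cnj (b * k) = c * cnj k)"
    by (auto simp: conformal_linear_def)
  then show "a = 0 \<or> b = 0"
  proof
    assume "\<forall>k. a * k + cnj (b * k) = c * k"
    from this[rule_format, of 1] this[rule_format, of \<i>] show ?thesis by (auto simp: complex_eq_iff)
  next
    assume "\<forall>k. a * k + cnj (b * k) = c * cnj k"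
    from this[rule_format, of 1] this[rule_format, of \<i>] show ?thesis by (auto simp: complex_eq_iff)
  qed
next
  assume "a = 0 \<or> b = 0"
  then show "conformal_linear (\<lambda>k. a * k + cnj (b * k))"
    by (auto simp: conformal_linear_def)
qed

lemma onorm_conformal:
  assumes "a = 0 \<or> b = 0"
  shows "onorm (\<lambda>k. a * k + cnj (b * k)) = norm a + norm b"
proof (rule onorm_eqI_norm_multiple)
  show "bounded_linear (\<lambda>k. a * k + cnj (b * k))"
    by (intro bounded_linear_add bounded_linear_mult_right
        bounded_linear_compose[OF bounded_linear_cnj])
  show "norm (a * k + cnj (b * k)) = (norm a + norm b) * norm k" for k
    using assms by (auto simp: norm_mult)
qed

lemma harmonic_pair_imp_admissible:
  assumes hg: "harmonic_pair D p h g" and g: "deriv g 0 = 0"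
  shows "admissible D p (\<lambda>z. h z + cnj (g z))"
    and "onorm (frechet_derivative (\<lambda>z. h z + cnj (g z)) (at 0)) = norm (deriv h 0)"
proof -
  note frechet = frechet_derivative_harmonic_pair[OF hg]
  show "onorm (frechet_derivative (\<lambda>z. h z + cnj (g z)) (at 0)) = norm (deriv h 0)"
    using g unfolding frechet by (subst onorm_conformal) simp_all
  have "conformal_linear (frechet_derivative (\<lambda>z. h z + cnj (g z)) (at 0))"
    using g unfolding frechet conformal_linear_iff by simp
  then show "admissible D p (\<lambda>z. h z + cnj (g z))"
    using hg harmonic_on_holomorphic_plus_cnj[OF open_ball]
    by (auto simp: admissible_def harmonic_pair_def)
qed

lemma admissible_imp_harmonic_pair:
  assumes f: "admissible D p f"
  obtains h g where "harmonic_pair D p h g"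
    "frechet_derivative f (at 0) = (\<lambda>k. deriv h 0 * k + cnj (deriv g 0 * k))"
proof -
  have "harmonic_on (ball 0 1) f" and f_0: "f 0 = p"
    using f by (simp_all add: admissible_def)
  then obtain h g where hol: "h holomorphic_on ball 0 1" "g holomorphic_on ball 0 1"
    and f_eq: "\<forall>z\<in>ball 0 1. f z = h z + cnj (g z)" and at_0: "h 0 = p / 2" "g 0 = cnj (p / 2)"
    using harmonic_on_imp_holomorphic_plus_cnj[OF open_ball convex_ball, of 0] f_0
    by (metis centre_in_ball zero_less_one)
  have "h z + cnj (g z) \<in> D" if "z \<in> ball 0 1" for z
    using f f_eq that by (force simp: admissible_def)
  then have pair: "harmonic_pair D p h g"
    using hol at_0 by (simp add: harmonic_pair_def)
  have "frechet_derivative (\<lambda>z. h z + cnj (g z)) (at 0) = frechet_derivative f (at 0)"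
  proof (rule frechet_derivative_transform_within_open[OF _ open_ball[of 0 1]])
    show "(\<lambda>z. h z + cnj (g z)) differentiable at 0"
      using has_derivative_harmonic_pair[OF pair] by (rule differentiableI)
  qed (auto simp: f_eq)
  then show ?thesis using that[OF pair] frechet_derivative_harmonic_pair[OF pair] by simp
qed

lemma deriv_reflect:
  assumes "h holomorphic_on S" "open S" "cnj z \<in> S"
  shows "deriv (cnj \<circ> h \<circ> cnj) z = cnj (deriv h (cnj z))"
  by (intro DERIV_imp_deriv has_field_derivative_cnj_cnj holomorphic_derivI[OF assms])

lemma admissible_imp_onorm_in_conformal_norms:
  assumes f: "admissible D p f"
  shows "onorm (frechet_derivative f (at 0)) \<in> conformal_norms D p"
proof -
  obtain h g where pair: "harmonic_pair D p h g"
    and frechet: "frechet_derivative f (at 0) = (\<lambda>k. deriv h 0 * k + cnj (deriv g 0 * k))"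
    using admissible_imp_harmonic_pair[OF f] by blast
  have conformal: "deriv h 0 = 0 \<or> deriv g 0 = 0"
    using f unfolding admissible_def frechet conformal_linear_iff by blast
  have onorm: "onorm (frechet_derivative f (at 0)) = norm (deriv h 0) + norm (deriv g 0)"
    unfolding frechet by (rule onorm_conformal[OF conformal])
  from conformal show ?thesis
  proof
    assume "deriv g 0 = 0"
    then show ?thesis using conformal_normsI[OF pair] by (simp add: onorm)
  next
    assume h: "deriv h 0 = 0"
    have "deriv (cnj \<circ> h \<circ> cnj) 0 = cnj (deriv h 0)" "deriv (cnj \<circ> g \<circ> cnj) 0 = cnj (deriv g 0)"
      using pair deriv_reflect[of h "ball 0 1" 0] deriv_reflect[of g "ball 0 1" 0]
      by (simp_all add: harmonic_pair_def)
    then show ?thesis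
      using conformal_normsI[OF harmonic_pair_reflect[OF pair]] by (simp add: onorm h)
  qed
qed

lemma admissible_onorms_eq_conformal_norms:
  "{onorm (frechet_derivative f (at 0)) | f. admissible D p f} = conformal_norms D p"
proof (intro equalityI subsetI)
  fix x assume "x \<in> conformal_norms D p"
  then obtain h g where "harmonic_pair D p h g" "deriv g 0 = 0" "x = norm (deriv h 0)"
    by (auto simp: conformal_norms_def)
  then show "x \<in> {onorm (frechet_derivative f (at 0)) | f. admissible D p f}"
    using harmonic_pair_imp_admissible by (metis (mono_tags, lifting) mem_Collect_eq)
qed (use admissible_imp_onorm_in_conformal_norms in blast)

lemma conformal_norms_nonempty:
  assumes "p \<in> D"
  shows "conformal_norms D p \<noteq> {}"
proof -
  have "harmonic_pair D p (\<lambda>_. p / 2) (\<lambda>_. cnj p / 2)"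
    using assms by (simp add: harmonic_pair_def)
  from conformal_normsI[OF this] show ?thesis by auto
qed

lemma conformal_norms_le_mean_width:
  assumes "bounded D" "x \<in> conformal_norms D p"
  shows "x \<le> mean_width D / 2"
  using assms harmonic_pair_deriv_growth(1)[of D p _ _ 0] by (auto simp: conformal_norms_def)

theorem theorem2p1:
  fixes D :: "complex set" and p :: complex
  assumes "open D" and "connected D" and "D \<noteq> {}" and "bounded D" and "convex D"
    and "p \<in> D"
  shows "(\<exists>f. admissible D p f \<and> onorm (frechet_derivative f (at 0)) = M D p) \<and>
         M D p \<le> perimeter D / (2 * pi)"
proof -
  have M_eq: "M D p = Sup (conformal_norms D p)"
    unfolding M_def admissible_onorms_eq_conformal_norms ..
  have "M D p \<in> conformal_norms D p"
    unfolding M_eq using conformal_norms_le_mean_width[OF assms(4)]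
    by (intro closed_contains_Sup conformal_norms_nonempty closed_conformal_norms bdd_aboveI assms)
  moreover from this have "M D p \<le> mean_width D / 2"
    by (rule conformal_norms_le_mean_width[OF assms(4)])
  then have "M D p \<le> perimeter D / (2 * pi)"
    by (simp add: Cauchy_perimeter_formula assms)
  ultimately show ?thesis
    unfolding admissible_onorms_eq_conformal_norms[symmetric] by auto
qed

end
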